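(* The maximum of $\mathcal{C}_1^{(4)}$ over all 4-qubit CSX-states $$|\psi_X^{(4)}\rangle=a|0000\rangle+c\,\overbrace{|0011\rangle}+d\,\overbrace{|0101\rangle}+f|1111\rangle,\qquad a,c,d,f\in\mathbb{C},\ |a|^2+|c|^2+|d|^2+|f|^2=1,$$ is equal to $\frac12$, and it is attained at $d=0$, $a=c=f=\frac1{\sqrt3}$.
   Context: For a bit string $i_1\dots i_n$, $\overbrace{|i_1 i_2\dots i_n\rangle}$ denotes the normalized equal-weight superposition of the distinct computational basis vectors obtained from $|i_1\dots i_n\rangle$ by cyclic permutations of the $n$ tensor factors. Thus $\overbrace{|0011\rangle}=\frac12(|0011\rangle+|1001\rangle+|1100\rangle+|0110\rangle)$ and $\overbrace{|0101\rangle}=\frac1{\sqrt2}(|0101\rangle+|1010\rangle)$. A CSX-state is a pure state invariant under cyclic permutations of the parties which is a superposition only of computational basis elements containing an even number of 1's; for 4 qubits these are exactly the states displayed in the claim. For a two-qubit density matrix $\rho$, the (Wootters) concurrence is $\mathcal{C}(\rho)=\max\{0,\lambda_1-\lambda_2-\lambda_3-\lambda_4\}$, where $\lambda_1\ge\lambda_2\ge\lambda_3\ge\lambda_4$ are the square roots of the eigenvalues of $\rho\tilde\rho$, with $\tilde\rho=(\sigma_y\otimes\sigma_y)\rho^*(\sigma_y\otimes\sigma_y)$ and $\rho^*$ the entrywise complex conjugate in the computational basis. $\mathcal{C}_1^{(4)}$ of a cyclically symmetric 4-qubit state is the concurrence of the reduced density matrix of two adjacent parties (labels differing by 1 mod 4).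 *)

theory Defs
  imports
    Complex_Main
    "HOL-Computational_Algebra.Computational_Algebra"
    "Jordan_Normal_Form.Char_Poly"
begin

text \<open>
  A vector of the \<open>n\<close>-qubit space is given by its amplitudes in the computational basis: the
  amplitude at a bit string of length \<open>n\<close> is its coefficient at the corresponding basis vector
  (\<open>False\<close> for 0, \<open>True\<close> for 1), and it is zero at strings of any other length.
  Parties are numbered from \<open>0\<close> to \<open>n - 1\<close>.
\<close>

type_synonym qstate = "bool list \<Rightarrow> complex"

definition ket :: "bool list \<Rightarrow> qstate" where
  "ket bs = (\<lambda>x. of_bool (x = bs))"

definition cyclic_class :: "'a list \<Rightarrow> 'a list set" where
  "cyclic_class bs = range (\<lambda>k. rotate k bs)"

definition cyc_ket :: "bool list \<Rightarrow> qstate" where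
  "cyc_ket bs = (\<lambda>x. (\<Sum>b\<in>cyclic_class bs. ket b x) /
     complex_of_real (sqrt (real (card (cyclic_class bs)))))"

text \<open>
  Cyclic invariance is invariance of the vector itself, not merely up to a phase; this is what makes
  the four-parameter family below exhaustive for four qubits (lemma \<open>csx_state_4_iff\<close>).
\<close>

definition csx_state :: "nat \<Rightarrow> qstate \<Rightarrow> bool" where
  "csx_state n \<psi> \<longleftrightarrow>
     (\<forall>x. length x \<noteq> n \<longrightarrow> \<psi> x = 0) \<and>
     (\<Sum>x | length x = n. (cmod (\<psi> x))\<^sup>2) = 1 \<and>
     (\<forall>x. \<psi> (rotate1 x) = \<psi> x) \<and>
     (\<forall>x. odd (count_list x True) \<longrightarrow> \<psi> x = 0)"

definition psi_X4 :: "complex \<Rightarrow> complex \<Rightarrow> complex \<Rightarrow> complex \<Rightarrow> qstate" where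
  "psi_X4 a c d f = (\<lambda>x.
     a * ket [False, False, False, False] x +
     c * cyc_ket [False, False, True, True] x +
     d * cyc_ket [False, True, False, True] x +
     f * ket [True, True, True, True] x)"

text \<open>
  Reduced density matrix of parties \<open>p\<close> and \<open>q\<close> (in this order) of the pure state \<open>\<psi>\<close>, that is, the
  partial trace of the projector onto \<open>\<psi>\<close> over all other parties. Rows and columns are ordered as
  \<open>00, 01, 10, 11\<close>.
\<close>

definition pair_index :: "nat \<Rightarrow> nat \<Rightarrow> bool list \<Rightarrow> nat" where
  "pair_index p q x = 2 * of_bool (x ! p) + of_bool (x ! q)"

definition reduced_pair :: "nat \<Rightarrow> nat \<Rightarrow> nat \<Rightarrow> qstate \<Rightarrow> complex mat" where
  "reduced_pair n p q \<psi> = mat 4 4 (\<lambda>(k, l).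
     \<Sum>(x, y) | length x = n \<and> length y = n \<and>
        pair_index p q x = k \<and> pair_index p q y = l \<and>
        (\<forall>r<n. r \<noteq> p \<and> r \<noteq> q \<longrightarrow> x ! r = y ! r).
       \<psi> x * cnj (\<psi> y))"

definition kron :: "complex mat \<Rightarrow> complex mat \<Rightarrow> complex mat" where
  "kron A B = mat (dim_row A * dim_row B) (dim_col A * dim_col B)
     (\<lambda>(i, j). A $$ (i div dim_row B, j div dim_col B) * B $$ (i mod dim_row B, j mod dim_col B))"

definition sigma_y :: "complex mat" where
  "sigma_y = mat_of_rows_list 2 [[0, - \<i>], [\<i>, 0]]"

definition spin_flip :: "complex mat \<Rightarrow> complex mat" where
  "spin_flip \<rho> = kron sigma_y sigma_y * map_mat cnj \<rho> * kron sigma_y sigma_y"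

text \<open>
  The eigenvalues of \<open>\<rho> * spin_flip \<rho>\<close>, with multiplicity, are the roots of its characteristic
  polynomial. They are real and nonnegative whenever \<open>\<rho>\<close> is a density matrix, so taking real parts
  only changes the type.
\<close>

definition concurrence_lambdas :: "complex mat \<Rightarrow> real list" where
  "concurrence_lambdas \<rho> = rev (sorted_list_of_multiset
     (image_mset (\<lambda>z. sqrt (Re z)) (proots (char_poly (\<rho> * spin_flip \<rho>)))))"

definition concurrence :: "complex mat \<Rightarrow> real" where
  "concurrence \<rho> = (let \<Lambda> = concurrence_lambdas \<rho> in
     max 0 (\<Lambda> ! 0 - \<Lambda> ! 1 - \<Lambda> ! 2 - \<Lambda> ! 3))"

text \<open>
  Concurrence of the parties \<open>p\<close> and \<open>p + k\<close> (labels modulo \<open>n\<close>). For a cyclically symmetric state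
  this does not depend on \<open>p\<close>.
\<close>

definition cyclic_concurrence :: "nat \<Rightarrow> nat \<Rightarrow> nat \<Rightarrow> qstate \<Rightarrow> real" where
  "cyclic_concurrence n k p \<psi> = concurrence (reduced_pair n p ((p + k) mod n) \<psi>)"

lemma cyclic_class_mod: "cyclic_class bs = (\<lambda>k. rotate k bs) ` {..<length bs}" if "bs \<noteq> []"
proof
  show "cyclic_class bs \<subseteq> (\<lambda>k. rotate k bs) ` {..<length bs}"
  proof
    fix x assume "x \<in> cyclic_class bs"
    then obtain k where "x = rotate k bs" unfolding cyclic_class_def by blast
    then have "x = rotate (k mod length bs) bs" using rotate_conv_mod by metis
    moreover have "k mod length bs \<in> {..<length bs}" using that by simp
    ultimately show "x \<in> (\<lambda>k. rotate k bs) ` {..<length bs}" by (rule image_eqI)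
  qed
  show "(\<lambda>k. rotate k bs) ` {..<length bs} \<subseteq> cyclic_class bs"
    unfolding cyclic_class_def by blast
qed

lemma cyclic_class_0011: "cyclic_class [False, False, True, True] =
    {[False, False, True, True], [False, True, True, False],
     [True, True, False, False], [True, False, False, True]}"
  by (subst cyclic_class_mod) (auto simp: lessThan_Suc numeral_eq_Suc rotate_def)

lemma cyclic_class_0101: "cyclic_class [False, True, False, True] =
    {[False, True, False, True], [True, False, True, False]}"
  by (subst cyclic_class_mod) (auto simp: lessThan_Suc numeral_eq_Suc rotate_def)

lemma length_4_cases:
  assumes "length (x :: bool list) = 4"
  shows "\<exists>p q r s. x = [p, q, r, s]"
  using assms by (auto simp: numeral_eq_Suc length_Suc_conv)

lemma cyc_ket_0011: "cyc_ket [False, False, True, True] x =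
    of_bool (x \<in> cyclic_class [False, False, True, True]) / 2"
  by (auto simp: cyc_ket_def ket_def cyclic_class_0011)

lemma cyc_ket_0101: "cyc_ket [False, True, False, True] x =
    of_bool (x \<in> cyclic_class [False, True, False, True]) / complex_of_real (sqrt 2)"
  by (auto simp: cyc_ket_def ket_def cyclic_class_0101)

lemma bool_lists_4: "{x :: bool list. length x = 4} =
    (\<lambda>(p, q, r, s). [p, q, r, s]) ` (UNIV \<times> UNIV \<times> UNIV \<times> UNIV)"
  using length_4_cases by (fastforce simp: image_iff)

lemma sum_bool_lists_4:
  fixes g :: "bool list \<Rightarrow> real"
  shows "(\<Sum>x | length x = 4. g x) =
    (\<Sum>p\<in>UNIV. \<Sum>q\<in>UNIV. \<Sum>r\<in>UNIV. \<Sum>s\<in>UNIV. g [p, q, r, s])"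
  unfolding bool_lists_4
  by (subst sum.reindex) (auto simp: inj_on_def sum.cartesian_product case_prod_unfold)

lemma norm_psi_X4: "(\<Sum>x | length x = 4. (cmod (psi_X4 a c d f x))\<^sup>2) =
    (cmod a)\<^sup>2 + (cmod c)\<^sup>2 + (cmod d)\<^sup>2 + (cmod f)\<^sup>2"
  unfolding sum_bool_lists_4 psi_X4_def cyc_ket_0011 cyc_ket_0101 cyclic_class_0011 cyclic_class_0101
  by (simp add: UNIV_bool ket_def norm_divide power_divide)

lemma csx_state_4_iff:
  "csx_state 4 \<psi> \<longleftrightarrow>
     (\<exists>a c d f. (cmod a)\<^sup>2 + (cmod c)\<^sup>2 + (cmod d)\<^sup>2 + (cmod f)\<^sup>2 = 1 \<and> \<psi> = psi_X4 a c d f)"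
proof
  assume "csx_state 4 \<psi>"
  then have len: "\<And>x. length x \<noteq> 4 \<Longrightarrow> \<psi> x = 0"
    and nrm: "(\<Sum>x | length x = 4. (cmod (\<psi> x))\<^sup>2) = 1"
    and rot: "\<And>x. \<psi> (rotate1 x) = \<psi> x"
    and evn: "\<And>x. odd (count_list x True) \<Longrightarrow> \<psi> x = 0"
    by (auto simp: csx_state_def)
  have rot4: "\<psi> [q, r, s, p] = \<psi> [p, q, r, s]" for p q r s
    using rot[of "[p, q, r, s]"] by simp
  define a where "a = \<psi> [False, False, False, False]"
  define c where "c = 2 * \<psi> [False, False, True, True]"
  define d where "d = complex_of_real (sqrt 2) * \<psi> [False, True, False, True]"
  define f where "f = \<psi> [True, True, True, True]"
  have orb: "\<psi> [False, True, True, False] = \<psi> [False, False, True, True]"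
      "\<psi> [True, True, False, False] = \<psi> [False, False, True, True]"
      "\<psi> [True, False, False, True] = \<psi> [False, False, True, True]"
      "\<psi> [True, False, True, False] = \<psi> [False, True, False, True]"
    using rot4[of False False True True] rot4[of False True True False]
      rot4[of True True False False] rot4[of False True False True] by simp_all
  have "\<psi> x = psi_X4 a c d f x" for x
  proof (cases "length x = 4")
    case True
    then obtain p q r s where x: "x = [p, q, r, s]" using length_4_cases by blast
    show ?thesis
      unfolding x psi_X4_def cyc_ket_0011 cyc_ket_0101 cyclic_class_0011 cyclic_class_0101
        a_def c_def d_def f_def ket_def
      using orb evn[of x]
      by (cases p; cases q; cases r; cases s) (simp_all add: x)
  next
    case False
    then show ?thesis
      by (auto simp: len psi_X4_def cyc_ket_0011 cyc_ket_0101 cyclic_class_0011 cyclic_class_0101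
          ket_def)
  qed
  then have eq: "\<psi> = psi_X4 a c d f" by blast
  with nrm have "(cmod a)\<^sup>2 + (cmod c)\<^sup>2 + (cmod d)\<^sup>2 + (cmod f)\<^sup>2 = 1"
    by (simp add: norm_psi_X4)
  with eq show "\<exists>a c d f. (cmod a)\<^sup>2 + (cmod c)\<^sup>2 + (cmod d)\<^sup>2 + (cmod f)\<^sup>2 = 1 \<and> \<psi> = psi_X4 a c d f"
    by blast
next
  assume "\<exists>a c d f. (cmod a)\<^sup>2 + (cmod c)\<^sup>2 + (cmod d)\<^sup>2 + (cmod f)\<^sup>2 = 1 \<and> \<psi> = psi_X4 a c d f"
  then obtain a c d f where nrm: "(cmod a)\<^sup>2 + (cmod c)\<^sup>2 + (cmod d)\<^sup>2 + (cmod f)\<^sup>2 = 1"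
    and psi: "\<psi> = psi_X4 a c d f" by blast
  have len: "\<psi> x = 0" if "length x \<noteq> 4" for x
    using that by (auto simp: psi psi_X4_def cyc_ket_0011 cyc_ket_0101 cyclic_class_0011
        cyclic_class_0101 ket_def)
  have rot: "\<psi> (rotate1 x) = \<psi> x" for x
  proof (cases "length x = 4")
    case True
    then obtain p q r s where x: "x = [p, q, r, s]" using length_4_cases by blast
    show ?thesis
      unfolding x psi psi_X4_def cyc_ket_0011 cyc_ket_0101 cyclic_class_0011 cyclic_class_0101 ket_def
      by (cases p; cases q; cases r; cases s) simp_all
  qed (simp add: len)
  have "\<psi> x = 0" if "odd (count_list x True)" for x
    using that by (auto simp: psi psi_X4_def cyc_ket_0011 cyc_ket_0101 cyclic_class_0011
        cyclic_class_0101 ket_def)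
  with len rot nrm show "csx_state 4 \<psi>"
    by (auto simp: csx_state_def psi norm_psi_X4)
qed

end

(*
  The reduced state of two adjacent parties is an X-shaped matrix with diagonal A, R, R, D and
  off-diagonal entries w and z. Multiplying it by its spin flip gives an X-shaped matrix again, so the
  characteristic polynomial splits and the square roots of its eigenvalues are P + |w|, |P - |w||,
  R + |z| and |R - |z||, where P = sqrt (A * D). The concurrence is therefore at most
  2 max {0, |w| - R, |z| - P}, and completing squares with the normalization constraint bounds both
  |w| - R and |z| - P by 1/4.
*)
theory Submission
  imports Defs
begin

section \<open>Independence of the choice of adjacent pair\<close>

lemma pair_index_rotate:
  assumes "length x = n" "p < n" "k < n"
  shows "pair_index 0 k (rotate p x) = pair_index p ((p + k) mod n) x"
  using assms by (simp add: pair_index_def nth_rotate)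

text \<open>On natural numbers \<open>n - p\<close> serves as the additive inverse of
  \<open>p\<close> modulo \<open>n\<close>.\<close>

lemma mod_add_complement:
  assumes "p < n" "r < (n::nat)"
  shows "(n - p + (p + r) mod n) mod n = r" "(p + (n - p + r) mod n) mod n = r"
proof -
  have e: "n - p + (p + r) = r + n" "p + (n - p + r) = r + n" using assms by auto
  show "(n - p + (p + r) mod n) mod n = r" "(p + (n - p + r) mod n) mod n = r"
    unfolding mod_add_right_eq e using assms by simp_all
qed

text \<open>Translation by \<open>p\<close> permutes the residues modulo \<open>n\<close> and
  carries 0 and \<open>k\<close> to the second pair of parties. This transports the condition of the
  partial trace that two strings agree on every traced-out party.\<close>

lemma all_less_rotate:
  fixes n p k :: nat
  assumes "p < n" "k < n"
  shows "(\<forall>r<n. r \<noteq> 0 \<and> r \<noteq> k \<longrightarrow> P ((p + r) mod n)) \<longleftrightarrow>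
         (\<forall>r<n. r \<noteq> p \<and> r \<noteq> (p + k) mod n \<longrightarrow> P r)"
proof -
  have bij: "bij_betw (\<lambda>r. (p + r) mod n) {..<n} {..<n}"
  proof (rule bij_betw_byWitness[where f' = "\<lambda>r. (n - p + r) mod n"])
    show "\<forall>r\<in>{..<n}. (n - p + (p + r) mod n) mod n = r"
      using mod_add_complement(1)[OF assms(1)] by blast
    show "\<forall>r\<in>{..<n}. (p + (n - p + r) mod n) mod n = r"
      using mod_add_complement(2)[OF assms(1)] by blast
  qed (use assms in auto)
  have inj: "r = s" if "(p + r) mod n = (p + s) mod n" "r < n" "s < n" for r s
    by (rule inj_onD[OF bij_betw_imp_inj_on[OF bij]]) (use that in simp_all)
  have p: "p = (p + 0) mod n" using assms by simp
  have eq_p: "(p + r) mod n = p \<longleftrightarrow> r = 0" if "r < n" for r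
    using inj[of r 0] p that assms by (metis gr_zeroI not_less_zero)
  have eq_pk: "(p + r) mod n = (p + k) mod n \<longleftrightarrow> r = k" if "r < n" for r
    using inj[of r k] that assms by blast
  have "(\<forall>r\<in>{..<n}. r \<noteq> p \<and> r \<noteq> (p + k) mod n \<longrightarrow> P r) \<longleftrightarrow>
    (\<forall>r\<in>(\<lambda>r. (p + r) mod n) ` {..<n}. r \<noteq> p \<and> r \<noteq> (p + k) mod n \<longrightarrow> P r)"
    by (simp only: bij_betw_imp_surj_on[OF bij])
  also have "\<dots> \<longleftrightarrow> (\<forall>r\<in>{..<n}. r \<noteq> 0 \<and> r \<noteq> k \<longrightarrow> P ((p + r) mod n))"
    unfolding ball_simps by (intro ball_cong) (simp_all add: eq_p eq_pk)
  finally show ?thesis by (simp add: Ball_def)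
qed

text \<open>Rotating both strings by \<open>p\<close> is a bijection between the index sets of the
  two partial traces and leaves every amplitude unchanged. Hence the two reduced matrices coincide
  entry by entry.\<close>

lemma cyclic_concurrence_shift:
  assumes rot: "\<And>x. \<psi> (rotate1 x) = \<psi> x" and "p < n" "k < n"
  shows "cyclic_concurrence n k p \<psi> = cyclic_concurrence n k 0 \<psi>"
proof -
  have rotm: "\<psi> (rotate m x) = \<psi> x" for m x
    by (induction m) (simp_all add: rot)
  define S where "S = (\<lambda>p q i j. {(x, y). length x = n \<and> length y = n \<and>
        pair_index p q x = i \<and> pair_index p q y = j \<and>
        (\<forall>r<n. r \<noteq> p \<and> r \<noteq> q \<longrightarrow> x ! r = y ! r)})"
  have S_iff: "(rotate p x, rotate p y) \<in> S 0 k i j \<longleftrightarrow> (x, y) \<in> S p ((p + k) mod n) i j"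
    for x y i j
  proof (cases "length x = n \<and> length y = n")
    case True
    then show ?thesis
      using all_less_rotate[of p n k "\<lambda>r. x ! r = y ! r"] assms
      by (simp add: S_def pair_index_rotate nth_rotate)
  qed (auto simp: S_def)
  have "(\<Sum>(x, y)\<in>S p ((p + k) mod n) i j. \<psi> x * cnj (\<psi> y)) =
        (\<Sum>(x, y)\<in>S 0 k i j. \<psi> x * cnj (\<psi> y))" for i j
  \<comment> \<open>Rotation by \<open>n - p\<close> undoes rotation by \<open>p\<close> on strings
    of length \<open>n\<close>.\<close>
  proof (rule sum.reindex_bij_witness
      [where i = "map_prod (rotate (n - p)) (rotate (n - p))" and j = "map_prod (rotate p) (rotate p)"])
    fix u assume u: "u \<in> S 0 k i j"
    then obtain x y where xy: "u = (x, y)" "length x = n" "length y = n"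
      by (auto simp: S_def)
    have *: "rotate p (rotate (n - p) z) = z" if "length z = n" for z :: "bool list"
      using that \<open>p < n\<close> by (simp add: rotate_rotate)
    show "map_prod (rotate p) (rotate p) (map_prod (rotate (n - p)) (rotate (n - p)) u) = u"
      using xy * by simp
    show "map_prod (rotate (n - p)) (rotate (n - p)) u \<in> S p ((p + k) mod n) i j"
      using u xy * by (simp flip: S_iff)
  next
    fix u assume u: "u \<in> S p ((p + k) mod n) i j"
    then obtain x y where xy: "u = (x, y)" "length x = n" "length y = n"
      by (auto simp: S_def)
    show "map_prod (rotate (n - p)) (rotate (n - p)) (map_prod (rotate p) (rotate p) u) = u"
      using xy \<open>p < n\<close> by (simp add: rotate_rotate)
    show "map_prod (rotate p) (rotate p) u \<in> S 0 k i j"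
      using u xy by (simp add: S_iff)
    show "(case map_prod (rotate p) (rotate p) u of (x, y) \<Rightarrow> \<psi> x * cnj (\<psi> y)) =
        (case u of (x, y) \<Rightarrow> \<psi> x * cnj (\<psi> y))"
      using xy by (simp add: rotm)
  qed
  then have "reduced_pair n p ((p + k) mod n) \<psi> = reduced_pair n 0 k \<psi>"
    by (simp add: reduced_pair_def S_def)
  then show ?thesis
    using \<open>k < n\<close> by (simp add: cyclic_concurrence_def)
qed

section \<open>Concurrence in terms of the multiset of eigenvalues\<close>

text \<open>The first entry minus the other three is twice the maximum minus the sum. In this form
  the order of the smaller entries does not matter, so no case distinction on sorting is required
  later.\<close>

lemma concurrence_eq_Max:
  assumes "proots (char_poly (\<rho> * spin_flip \<rho>)) = {#z1, z2, z3, z4#}"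
  defines "M \<equiv> image_mset (\<lambda>z. sqrt (Re z)) {#z1, z2, z3, z4#}"
  shows "concurrence \<rho> = max 0 (2 * Max_mset M - sum_mset M)"
proof -
  define L where "L = concurrence_lambdas \<rho>"
  have L: "L = rev (sorted_list_of_multiset M)"
    by (simp add: L_def concurrence_lambdas_def assms)
  have mL: "mset L = M" by (simp add: L)
  have "size (mset L) = 4" by (simp only: mL) (simp add: M_def)
  then have "length L = 4" by simp
  then obtain a b c d where abcd: "L = [a, b, c, d]"
    by (auto simp: numeral_eq_Suc length_Suc_conv)
  have "sorted (rev L)" by (simp add: L)
  then have ord: "b \<le> a" "c \<le> a" "d \<le> a" by (auto simp: abcd)
  have M: "M = {#a, b, c, d#}" using mL abcd by simp
  have "Max_mset M = a" unfolding M using ord by (intro Max_eqI) auto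
  then show ?thesis
    unfolding concurrence_def Let_def L_def[symmetric] abcd M by simp
qed

section \<open>Algebra of X-shaped matrices\<close>

lemma det_dim_2:
  fixes A :: "'a::comm_ring_1 mat"
  assumes "A \<in> carrier_mat 2 2"
  shows "det A = A $$ (0, 0) * A $$ (1, 1) - A $$ (0, 1) * A $$ (1, 0)"
  using assms
  by (subst laplace_expansion_row[OF assms, of 0])
    (auto simp: cofactor_def det_single mat_delete_def lessThan_Suc numeral_2_eq_2)

lemma det_dim_3:
  fixes A :: "'a::comm_ring_1 mat"
  assumes A: "A \<in> carrier_mat 3 3"
  shows "det A =
    A $$ (0, 0) * (A $$ (1, 1) * A $$ (2, 2) - A $$ (1, 2) * A $$ (2, 1)) -
    A $$ (0, 1) * (A $$ (1, 0) * A $$ (2, 2) - A $$ (1, 2) * A $$ (2, 0)) +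
    A $$ (0, 2) * (A $$ (1, 0) * A $$ (2, 1) - A $$ (1, 1) * A $$ (2, 0))"
proof -
  have "mat_delete A i j \<in> carrier_mat 2 2" for i j
    using A by (auto simp: mat_delete_def)
  then show ?thesis
    using A
    by (subst laplace_expansion_row[OF assms, of 0])
      (auto simp: cofactor_def det_dim_2 mat_delete_def lessThan_Suc numeral_2_eq_2 numeral_3_eq_3 algebra_simps)
qed

text \<open>The primed entries are independent of the unprimed ones because the product of such a
  state with its spin flip need not be Hermitian. The entry type is general so that polynomial
  entries are covered as well.\<close>

definition X_mat :: "'a::zero \<Rightarrow> 'a \<Rightarrow> 'a \<Rightarrow> 'a \<Rightarrow> 'a \<Rightarrow> 'a \<Rightarrow> 'a \<Rightarrow> 'a \<Rightarrow> 'a mat" where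
  "X_mat a b c d w w' z z' =
     mat_of_rows_list 4 [[a, 0, 0, w], [0, b, z, 0], [0, z', c, 0], [w', 0, 0, d]]"

lemma X_mat_dim [simp]:
  "dim_row (X_mat a b c d w w' z z') = 4" "dim_col (X_mat a b c d w w' z z') = 4"
  by (simp_all add: X_mat_def mat_of_rows_list_def)

lemma X_mat_index:
  assumes "i < 4" "j < 4"
  shows "X_mat a b c d w w' z z' $$ (i, j) =
    [[a, 0, 0, w], [0, b, z, 0], [0, z', c, 0], [w', 0, 0, d]] ! i ! j"
  using assms by (simp add: X_mat_def mat_of_rows_list_def)

lemma eq_X_matI:
  assumes "A \<in> carrier_mat 4 4"
    and "\<And>i j. i < 4 \<Longrightarrow> j < 4 \<Longrightarrow>
      A $$ (i, j) = [[a, 0, 0, w], [0, b, z, 0], [0, z', c, 0], [w', 0, 0, d]] ! i ! j"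
  shows "A = X_mat a b c d w w' z z'"
  using assms by (intro eq_matI) (auto simp: X_mat_index)

lemma less_4_iff: "i < (4::nat) \<longleftrightarrow> i = 0 \<or> i = 1 \<or> i = 2 \<or> i = 3"
  by auto

text \<open>Reordering the basis as 00, 11, 01, 10 makes the matrix block diagonal with two 2 x 2
  blocks, whose determinants are the two factors.\<close>

lemma det_X_mat:
  fixes a :: "'a::comm_ring_1"
  shows "det (X_mat a b c d w w' z z') = (a * d - w * w') * (b * c - z * z')"
proof -
  let ?X = "X_mat a b c d w w' z z'"
  have X: "?X \<in> carrier_mat 4 4" by auto
  have "mat_delete ?X i j \<in> carrier_mat 3 3" for i j
    by (auto simp: mat_delete_def)
  moreover have "{..<4::nat} = {0, 1, 2, 3}" by auto
  ultimately show ?thesis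
    by (subst laplace_expansion_row[OF X, of 0])
      (auto simp: cofactor_def det_dim_3 mat_delete_def X_mat_index eval_nat_numeral algebra_simps)
qed

text \<open>The characteristic matrix is X-shaped over the polynomials, so its determinant splits
  into the two blocks; the signs of the off-diagonal entries cancel in pairs.\<close>

lemma char_poly_X_mat:
  "char_poly (X_mat a b c d w w' z z') =
     ([:- a, 1:] * [:- d, 1:] - [:w * w':]) * ([:- b, 1:] * [:- c, 1:] - [:z * z':])"
proof -
  have "char_poly_matrix (X_mat a b c d w w' z z') =
    X_mat [:- a, 1:] [:- b, 1:] [:- c, 1:] [:- d, 1:] [:- w:] [:- w':] [:- z:] [:- z':]"
    by (rule eq_matI) (auto simp: char_poly_matrix_def less_4_iff X_mat_index)
  then show ?thesis
    by (simp add: char_poly_def det_X_mat del: mult_pCons_left mult_pCons_right)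
      (simp add: mult.commute)
qed

lemma X_mat_mult:
  fixes a :: "'a::semiring_0"
  shows "X_mat a b c d w w' z z' * X_mat a2 b2 c2 d2 w2 w2' z2 z2' =
    X_mat (a * a2 + w * w2') (b * b2 + z * z2') (z' * z2 + c * c2) (w' * w2 + d * d2)
      (a * w2 + w * d2) (w' * a2 + d * w2') (b * z2 + z * c2) (z' * b2 + c * z2')"
proof (rule eq_X_matI)
  have "{0..<4::nat} = {0, 1, 2, 3}" by auto
  then show "(X_mat a b c d w w' z z' * X_mat a2 b2 c2 d2 w2 w2' z2 z2') $$ (i, j) =
    [[a * a2 + w * w2', 0, 0, a * w2 + w * d2], [0, b * b2 + z * z2', b * z2 + z * c2, 0],
     [0, z' * b2 + c * z2', z' * z2 + c * c2, 0], [w' * a2 + d * w2', 0, 0, w' * w2 + d * d2]] ! i ! j"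
    if "i < 4" "j < 4" for i j
    using that by (auto simp: less_4_iff scalar_prod_def X_mat_index)
qed auto

lemma map_X_mat:
  "f 0 = 0 \<Longrightarrow> map_mat f (X_mat a b c d w w' z z') =
     X_mat (f a) (f b) (f c) (f d) (f w) (f w') (f z) (f z')"
  by (rule eq_matI) (auto simp: less_4_iff X_mat_index)

section \<open>Spin flip and concurrence of X-shaped states\<close>

lemma kron_sigma_y: "kron sigma_y sigma_y = X_mat 0 0 0 0 (- 1) (- 1) 1 1"
proof -
  have "dim_row sigma_y = 2" "dim_col sigma_y = 2"
    "sigma_y $$ (0, 0) = 0" "sigma_y $$ (0, Suc 0) = - \<i>"
    "sigma_y $$ (Suc 0, 0) = \<i>" "sigma_y $$ (Suc 0, Suc 0) = 0"
    by (simp_all add: sigma_y_def mat_of_rows_list_def)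
  then show ?thesis
    by (intro eq_X_matI) (auto simp: less_4_iff kron_def)
qed

text \<open>Conjugation by an antidiagonal matrix reverses the order of rows and columns, and the
  signs cancel within each block. For a Hermitian argument only the diagonal is reversed.\<close>

lemma spin_flip_X_mat:
  "spin_flip (X_mat a b c d w w' z z') =
     X_mat (cnj d) (cnj c) (cnj b) (cnj a) (cnj w') (cnj w) (cnj z') (cnj z)"
  by (simp add: spin_flip_def kron_sigma_y map_X_mat X_mat_mult)

text \<open>The outer block of the product has both diagonal entries
  \<open>a * d + (cmod w)\<^sup>2\<close>, and its off-diagonal entries multiply to
  \<open>4 * (a * d) * (cmod w)\<^sup>2\<close>. Its eigenvalues are therefore the squares of
  \<open>P + cmod w\<close> and \<open>P - cmod w\<close>; the inner block is analogous with
  \<open>R\<close> and \<open>z\<close>.\<close>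

lemma proots_X_state:
  fixes a b c d :: real and w z :: complex
  assumes "P\<^sup>2 = a * d" "R\<^sup>2 = b * c"
  defines "\<rho> \<equiv> X_mat (of_real a) (of_real b) (of_real c) (of_real d) w (cnj w) z (cnj z)"
  shows "proots (char_poly (\<rho> * spin_flip \<rho>)) =
    {#of_real ((P + cmod w)\<^sup>2), of_real ((P - cmod w)\<^sup>2),
      of_real ((R + cmod z)\<^sup>2), of_real ((R - cmod z)\<^sup>2)#}"
proof -
  have factor: "[:- of_real (s + q\<^sup>2), 1:] * [:- of_real (s + q\<^sup>2), 1:] - [:of_real (4 * s * q\<^sup>2):] =
      [:- complex_of_real ((p + q)\<^sup>2), 1:] * [:- of_real ((p - q)\<^sup>2), 1:]"
    if "p\<^sup>2 = s" for p q s :: real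
    unfolding that[symmetric]
    by (simp add: power2_eq_square algebra_simps)
  have "\<rho> * spin_flip \<rho> =
    X_mat (of_real (a * d + (cmod w)\<^sup>2)) (of_real (b * c + (cmod z)\<^sup>2))
      (of_real (b * c + (cmod z)\<^sup>2)) (of_real (a * d + (cmod w)\<^sup>2))
      (2 * a * w) (2 * d * cnj w) (2 * b * z) (2 * c * cnj z)"
    unfolding \<rho>_def spin_flip_X_mat X_mat_mult
    by (simp add: complex_norm_square algebra_simps del: of_real_power)
  moreover have "2 * a * w * (2 * d * cnj w) = of_real (4 * (a * d) * (cmod w)\<^sup>2)"
    "2 * b * z * (2 * c * cnj z) = of_real (4 * (b * c) * (cmod z)\<^sup>2)"
    by (simp_all add: complex_norm_square mult_ac del: of_real_power)
  ultimately have "char_poly (\<rho> * spin_flip \<rho>) =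
    ([:- of_real ((P + cmod w)\<^sup>2), 1:] * [:- of_real ((P - cmod w)\<^sup>2), 1:]) *
    ([:- of_real ((R + cmod z)\<^sup>2), 1:] * [:- of_real ((R - cmod z)\<^sup>2), 1:])"
    by (simp only: char_poly_X_mat factor[OF assms(1)] factor[OF assms(2)])
  then show ?thesis
    by (simp add: proots_mult del: mult_pCons_left mult_pCons_right)
qed

text \<open>Since x + y + |x - y| = 2 max(x, y), the four square roots sum to twice
  \<open>max P (cmod w) + max R (cmod z)\<close>, while the largest is \<open>P + cmod w\<close> or
  \<open>R + cmod z\<close>. The minima and maxima remain because \<open>cmod w \<le> P\<close> and
  \<open>cmod z \<le> R\<close>, which positivity of the state would give, are not assumed.\<close>

lemma concurrence_X_state:
  fixes a b c d :: real and w z :: complex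
  assumes "0 \<le> a * d" "0 \<le> b * c"
  defines "\<rho> \<equiv> X_mat (of_real a) (of_real b) (of_real c) (of_real d) w (cnj w) z (cnj z)"
  defines "P \<equiv> sqrt (a * d)" and "R \<equiv> sqrt (b * c)"
  shows "concurrence \<rho> =
    max 0 (2 * max (min P (cmod w) - max R (cmod z)) (min R (cmod z) - max P (cmod w)))"
proof -
  have PR: "P\<^sup>2 = a * d" "R\<^sup>2 = b * c" "0 \<le> P" "0 \<le> R" using assms by auto
  define M where "M = {#P + cmod w, \<bar>P - cmod w\<bar>, R + cmod z, \<bar>R - cmod z\<bar>#}"
  have M: "image_mset (\<lambda>z. sqrt (Re z)) {#of_real ((P + cmod w)\<^sup>2), of_real ((P - cmod w)\<^sup>2),
      of_real ((R + cmod z)\<^sup>2), of_real ((R - cmod z)\<^sup>2)#} = M"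
    using PR by (simp add: M_def del: of_real_power)
  have "concurrence \<rho> = max 0 (2 * Max_mset M - sum_mset M)"
    using concurrence_eq_Max[OF proots_X_state[OF PR(1,2)], of w z] unfolding M
    by (simp only: \<rho>_def)
  moreover have "Max_mset M = max (P + cmod w) (R + cmod z)"
  proof -
    have "\<bar>P - cmod w\<bar> \<le> P + cmod w"
      using PR by (intro abs_leI) simp_all
    moreover have "\<bar>R - cmod z\<bar> \<le> R + cmod z"
      using PR by (intro abs_leI) simp_all
    moreover have "Max_mset M = max (max (P + cmod w) \<bar>P - cmod w\<bar>) (max (R + cmod z) \<bar>R - cmod z\<bar>)"
      by (simp add: M_def max.assoc)
    ultimately show ?thesis
      by (simp only: max_absorb1)
  qed
  moreover have "2 * max (P + cmod w) (R + cmod z) - sum_mset M =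
      2 * max (min P (cmod w) - max R (cmod z)) (min R (cmod z) - max P (cmod w))"
    using PR norm_ge_zero[of w] norm_ge_zero[of z] by (simp add: M_def max_def min_def abs_if)
  ultimately show ?thesis
    by (simp only:)
qed

section \<open>Reduced state of two adjacent parties\<close>

lemma reduced_pair_4_index:
  "reduced_pair 4 0 1 \<psi> $$ (2 * of_bool i + of_bool j, 2 * of_bool k + of_bool l) =
    (\<Sum>r\<in>UNIV. \<Sum>s\<in>UNIV. \<psi> [i, j, r, s] * cnj (\<psi> [k, l, r, s]))"
proof -
  have pair_eq: "2 * of_bool u + of_bool v = 2 * of_bool i + (of_bool j :: nat) \<longleftrightarrow> u = i \<and> v = j"
    for u v i j :: bool by auto
  have "{(x, y). length x = 4 \<and> length y = 4 \<and>
      pair_index 0 1 x = 2 * of_bool i + of_bool j \<and> pair_index 0 1 y = 2 * of_bool k + of_bool l \<and>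
      (\<forall>r<4. r \<noteq> 0 \<and> r \<noteq> 1 \<longrightarrow> x ! r = y ! r)} =
    (\<lambda>(r, s). ([i, j, r, s], [k, l, r, s])) ` (UNIV \<times> UNIV)" (is "?S = ?T")
  proof
    show "?S \<subseteq> ?T"
    proof clarify
      fix x y :: "bool list"
      assume "length x = 4" "length y = 4"
        and idx: "pair_index 0 1 x = 2 * of_bool i + of_bool j"
          "pair_index 0 1 y = 2 * of_bool k + of_bool l"
        and eq: "\<forall>r<4. r \<noteq> 0 \<and> r \<noteq> 1 \<longrightarrow> x ! r = y ! r"
      then obtain x0 x1 x2 x3 y0 y1 y2 y3 where xy: "x = [x0, x1, x2, x3]" "y = [y0, y1, y2, y3]"
        using length_4_cases by meson
      have "x2 = y2" "x3 = y3"
        using eq[rule_format, of 2] eq[rule_format, of 3] by (simp_all add: xy)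
      moreover have "x0 = i" "x1 = j" "y0 = k" "y1 = l"
        using idx by (simp_all add: xy pair_index_def pair_eq)
      ultimately show "(x, y) \<in> ?T"
        by (auto simp: xy)
    qed
    show "?T \<subseteq> ?S"
      by (auto simp: pair_index_def less_4_iff)
  qed
  moreover have "2 * of_bool i + of_bool j < (4::nat)" for i j by auto
  ultimately show ?thesis
    by (simp add: reduced_pair_def sum.reindex inj_on_def sum.cartesian_product case_prod_unfold)
qed

text \<open>Amplitudes vanish at strings of odd weight and the traced-out bits are common to both
  strings, so a nonzero entry needs row and column bits of equal parity. This forces the X
  shape.\<close>

lemma reduced_pair_psi_X4:
  fixes a c d f :: complex
  defines "h \<equiv> complex_of_real (sqrt 2)"
  defines "w \<equiv> (a * cnj c + c * cnj f) / 2"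
    and "z \<equiv> (c * cnj d + d * cnj c) / (2 * h)"
    and "R \<equiv> (cmod c)\<^sup>2 / 4 + (cmod d)\<^sup>2 / 2"
  shows "reduced_pair 4 0 1 (psi_X4 a c d f) =
    X_mat (of_real ((cmod a)\<^sup>2 + (cmod c)\<^sup>2 / 4)) (of_real R) (of_real R)
      (of_real ((cmod c)\<^sup>2 / 4 + (cmod f)\<^sup>2)) w (cnj w) z (cnj z)"
proof (rule eq_X_matI)
  have sq: "cnj h = h" "h * h = 2"
    by (simp_all add: h_def flip: of_real_mult)
  have norm_sq: "(complex_of_real (cmod x))\<^sup>2 = x * cnj x" for x
    by (metis complex_norm_square of_real_power)
  note amp = psi_X4_def cyc_ket_0011 cyc_ket_0101 cyclic_class_0011 cyclic_class_0101 ket_def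
  \<comment> \<open>The witnesses are the two binary digits of the index, high bit first.\<close>
  have index: "\<exists>u v. i = 2 * of_bool u + of_bool v" if "i < 4" for i :: nat
    using that by (intro exI[of _ "2 \<le> i"] exI[of _ "odd i"]) (auto simp: less_4_iff)
  fix i j :: nat
  assume "i < 4" "j < 4"
  show "reduced_pair 4 0 1 (psi_X4 a c d f) $$ (i, j) =
    [[of_real ((cmod a)\<^sup>2 + (cmod c)\<^sup>2 / 4), 0, 0, w], [0, of_real R, z, 0],
     [0, cnj z, of_real R, 0], [cnj w, 0, 0, of_real ((cmod c)\<^sup>2 / 4 + (cmod f)\<^sup>2)]] ! i ! j"
  proof -
    obtain u v u' v' where "i = 2 * of_bool u + of_bool v" "j = 2 * of_bool u' + of_bool v'"
      using index[OF \<open>i < 4\<close>] index[OF \<open>j < 4\<close>] by blast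
    then show ?thesis
      by (simp only: reduced_pair_4_index UNIV_bool,
          cases u; cases v; cases u'; cases v';
          simp add: amp norm_sq sq w_def z_def R_def add_divide_distrib add_ac mult_ac flip: h_def)
  qed
qed (simp add: reduced_pair_def)

lemma cyclic_concurrence_psi_X4:
  fixes p :: nat and a c d f :: complex
  assumes "p < 4"
  defines "P \<equiv> sqrt (((cmod a)\<^sup>2 + (cmod c)\<^sup>2 / 4) * ((cmod c)\<^sup>2 / 4 + (cmod f)\<^sup>2))"
    and "R \<equiv> (cmod c)\<^sup>2 / 4 + (cmod d)\<^sup>2 / 2"
    and "w \<equiv> (a * cnj c + c * cnj f) / 2"
    and "z \<equiv> (c * cnj d + d * cnj c) / (2 * complex_of_real (sqrt 2))"
  shows "cyclic_concurrence 4 1 p (psi_X4 a c d f) =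
    max 0 (2 * max (min P (cmod w) - max R (cmod z)) (min R (cmod z) - max P (cmod w)))"
proof -
  have len: "psi_X4 a c d f x = 0" if "length x \<noteq> 4" for x
    using that by (auto simp: psi_X4_def cyc_ket_0011 cyc_ket_0101 cyclic_class_0011
        cyclic_class_0101 ket_def)
  have rot: "psi_X4 a c d f (rotate1 x) = psi_X4 a c d f x" for x
  proof (cases "length x = 4")
    case True
    then obtain p q r s where x: "x = [p, q, r, s]" using length_4_cases by blast
    show ?thesis
      unfolding x psi_X4_def cyc_ket_0011 cyc_ket_0101 cyclic_class_0011 cyclic_class_0101 ket_def
      by (cases p; cases q; cases r; cases s) simp_all
  qed (simp add: len)
  have "cyclic_concurrence 4 1 p (psi_X4 a c d f) = concurrence (reduced_pair 4 0 1 (psi_X4 a c d f))"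
    using cyclic_concurrence_shift[of "psi_X4 a c d f", OF rot assms(1), of 1] by (simp add: cyclic_concurrence_def)
  \<comment> \<open>Both inner diagonal entries equal \<open>R\<close>, so the root of their product
    is \<open>R\<close> itself.\<close>
  moreover have "0 \<le> R * R" "sqrt (R * R) = R" by (simp_all add: R_def)
  moreover have "0 \<le> ((cmod a)\<^sup>2 + (cmod c)\<^sup>2 / 4) * ((cmod c)\<^sup>2 / 4 + (cmod f)\<^sup>2)" by simp
  ultimately show ?thesis
    using concurrence_X_state[of "(cmod a)\<^sup>2 + (cmod c)\<^sup>2 / 4" "(cmod c)\<^sup>2 / 4 + (cmod f)\<^sup>2" R R w z]
    by (simp only: reduced_pair_psi_X4 simp_thms flip: w_def z_def R_def P_def)
qed

section \<open>The upper bound and its attainment\<close>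

lemma cyclic_concurrence_psi_X4_le:
  assumes "p < 4" and nrm: "(cmod a)\<^sup>2 + (cmod c)\<^sup>2 + (cmod d)\<^sup>2 + (cmod f)\<^sup>2 = 1"
  shows "cyclic_concurrence 4 1 p (psi_X4 a c d f) \<le> 1 / 2"
proof -
  \<comment> \<open>The scaling turns the inner diagonal entry into
    \<open>C\<^sup>2 + D\<^sup>2\<close> and leaves all later inequalities polynomial.\<close>
  define A B C D where "A = cmod a" "B = cmod f" "C = cmod c / 2" "D = cmod d / sqrt 2"
  note ABCD = this
  have nrm': "A\<^sup>2 + B\<^sup>2 + 4 * C\<^sup>2 + 2 * D\<^sup>2 = 1"
    using nrm by (simp add: ABCD power_divide)
  have R: "(cmod c)\<^sup>2 / 4 + (cmod d)\<^sup>2 / 2 = C\<^sup>2 + D\<^sup>2"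
    by (simp add: ABCD power_divide)
  have "cmod ((a * cnj c + c * cnj f) / 2) \<le> C * (A + B)"
    using norm_triangle_ineq[of "a * cnj c" "c * cnj f"]
    by (simp add: ABCD norm_mult norm_divide algebra_simps)
  moreover have "2 * (C * (A + B)) - 2 * (C\<^sup>2 + D\<^sup>2) \<le> 1 / 2"
  proof -
    \<comment> \<open>By normalization this sum of squares is four times the gap in the claimed
      inequality. It vanishes exactly for A = B = 2C and D = 0, that is, for |a| = |c| = |f| and d =
      0.\<close>
    have "0 \<le> (A + B - 4 * C)\<^sup>2 + (A - B)\<^sup>2 + 12 * D\<^sup>2" by simp
    then show ?thesis using nrm' by (simp add: power2_eq_square algebra_simps)
  qed
  moreover have "cmod ((c * cnj d + d * cnj c) / (2 * complex_of_real (sqrt 2))) \<le> 2 * C * D"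
  proof -
    have "cmod (c * cnj d + d * cnj c) \<le> 2 * cmod c * cmod d"
      by (rule norm_triangle_le) (simp add: norm_mult)
    then show ?thesis by (simp add: ABCD norm_divide norm_mult field_simps)
  qed
  \<comment> \<open>Each factor under the root is at least \<open>C\<^sup>2\<close>; this cruder
    bound already suffices for the second difference.\<close>
  moreover have "C\<^sup>2 \<le> sqrt (((cmod a)\<^sup>2 + (cmod c)\<^sup>2 / 4) * ((cmod c)\<^sup>2 / 4 + (cmod f)\<^sup>2))"
  proof (rule real_le_rsqrt)
    have "C\<^sup>2 * C\<^sup>2 \<le> ((cmod a)\<^sup>2 + (cmod c)\<^sup>2 / 4) * ((cmod c)\<^sup>2 / 4 + (cmod f)\<^sup>2)"
      by (rule mult_mono) (simp_all add: ABCD power_divide)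
    then show "(C\<^sup>2)\<^sup>2 \<le> ((cmod a)\<^sup>2 + (cmod c)\<^sup>2 / 4) * ((cmod c)\<^sup>2 / 4 + (cmod f)\<^sup>2)"
      by (simp add: power2_eq_square)
  qed
  moreover have "2 * (2 * C * D) - 2 * C\<^sup>2 \<le> 1 / 2"
  proof -
    \<comment> \<open>By normalization the right-hand side is twice the gap in the claimed
      inequality.\<close>
    have "0 \<le> 2 * (D - 2 * C)\<^sup>2 + A\<^sup>2 + B\<^sup>2" by simp
    then show ?thesis using nrm' by (simp add: power2_eq_square algebra_simps)
  qed
  \<comment> \<open>Replacing each minimum and each maximum by one of its arguments only increases
    the differences, so it is enough to bound \<open>W - R\<close> and \<open>Z - P\<close>.\<close>
  moreover have max_diff_le: "max 0 (2 * max (min P W - max R Z) (min R Z - max P W)) \<le> 1 / 2"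
    if "2 * W - 2 * R \<le> 1 / 2" "2 * Z - 2 * P \<le> 1 / 2" for P W R Z :: real
  proof -
    have "min P W - max R Z \<le> W - R" "min R Z - max P W \<le> Z - P"
      by (simp_all add: diff_mono)
    then show ?thesis using that by (intro max.boundedI) (simp, smt (verit))
  qed
  ultimately show ?thesis
    unfolding cyclic_concurrence_psi_X4[OF assms(1)] R by (intro max_diff_le) linarith+
qed

text \<open>Here P = 5/12, |w| = 1/3, R = 1/12 and z = 0, so the value is 2 (1/3 - 1/12).\<close>

lemma cyclic_concurrence_optimum:
  assumes "p < 4"
  defines "s \<equiv> 1 / complex_of_real (sqrt 3)"
  shows "cyclic_concurrence 4 1 p (psi_X4 s s 0 s) = 1 / 2"
proof -
  have s: "(cmod s)\<^sup>2 = 1 / 3" "s * cnj s = 1 / 3"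
    by (simp_all add: s_def norm_divide power_divide flip: of_real_mult)
  have "(s * cnj s + s * cnj s) / 2 = 1 / 3" by (simp add: s)
  moreover have "sqrt ((1 / 3 + 1 / 3 / 4) * (1 / 3 / 4 + 1 / 3)) = (5 / 12 :: real)"
    by (rule real_sqrt_unique) (simp_all add: power2_eq_square)
  ultimately show ?thesis
    unfolding cyclic_concurrence_psi_X4[OF assms(1)] s by (simp add: norm_divide)
qed

theorem mainTheorem3:
  fixes p :: nat
  assumes "p < 4"
  shows "is_arg_max
           (\<lambda>(a, c, d, f). cyclic_concurrence 4 1 p (psi_X4 a c d f))
           (\<lambda>(a, c, d, f). (cmod a)\<^sup>2 + (cmod c)\<^sup>2 + (cmod d)\<^sup>2 + (cmod f)\<^sup>2 = 1)
           (1 / complex_of_real (sqrt 3), 1 / complex_of_real (sqrt 3), 0,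
            1 / complex_of_real (sqrt 3))
       \<and> cyclic_concurrence 4 1 p
           (psi_X4 (1 / complex_of_real (sqrt 3)) (1 / complex_of_real (sqrt 3)) 0
              (1 / complex_of_real (sqrt 3))) = 1 / 2"
proof -
  \<comment> \<open>This gives feasibility of the maximizer: three amplitudes of squared modulus 1/3
    and one zero amplitude.\<close>
  have "(cmod (1 / complex_of_real (sqrt 3)))\<^sup>2 = 1 / 3"
    by (simp add: norm_divide power_divide)
  then show ?thesis
    unfolding is_arg_max_linorder
    using cyclic_concurrence_psi_X4_le[OF assms]
    by (auto simp only: cyclic_concurrence_optimum[OF assms] split: prod.splits) simp_all
qed

end
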